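(* Let $A$ be an ordered alphabet, $A^{\ast}$ the free monoid on $A$ with the Higman ordering, and let $N(A^{\ast}):=\{Y\subseteq A^{\ast}: Y=Y^{\nabla\Delta}\}$ be its MacNeille completion (realized by closed upper sets), equipped with concatenation of languages. Then the monoid $N^{\circ}(A^{\ast}):=N(A^{\ast})\setminus\{\emptyset\}$ is free.
   Context: Higman ordering on $A^{\ast}$: for $\alpha=a_0\cdots a_{n-1}$ and $\beta=b_0\cdots b_{m-1}$, $\alpha\le\beta$ iff there is a strictly increasing map $h:\{0,\dots,n-1\}\to\{0,\dots,m-1\}$ with $a_i\le b_{h(i)}$ for all $i$. For $X\subseteq A^{\ast}$, $X^{\Delta}:=\bigcap_{x\in X}\uparrow x$ and $X^{\nabla}:=\bigcap_{x\in X}\downarrow x$, where $\uparrow x=\{\beta:x\le\beta\}$ and $\downarrow x=\{\alpha:\alpha\le x\}$ (with $\emptyset^{\Delta}=\emptyset^{\nabla}=A^{\ast}$). Concatenation of languages is $XY:=\{\alpha\beta:\alpha\in X,\beta\in Y\}$; $N(A^{\ast})$ is closed under concatenation and contains $A^{\ast}$, which is the neutral element. *)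

theory Defs
  imports "HOL-Algebra.Group" "HOL-Library.Sublist"
begin

text \<open>
  An ordered alphabet is a set \<open>A :: 'a::order set\<close> with the order induced from \<open>'a\<close>; using a
  carrier set rather than the whole type also allows the empty alphabet. The words are the elements
  of \<open>lists A\<close>.
\<close>

definition higman_le :: "'a::order list \<Rightarrow> 'a list \<Rightarrow> bool"
  where "higman_le \<alpha> \<beta> \<longleftrightarrow>
    (\<exists>h. strict_mono_on {..<length \<alpha>} h \<and> h ` {..<length \<alpha>} \<subseteq> {..<length \<beta>} \<and>
         (\<forall>i<length \<alpha>. \<alpha> ! i \<le> \<beta> ! h i))"

definition up_set :: "'a::order set \<Rightarrow> 'a list \<Rightarrow> 'a list set"
  where "up_set A x = {\<beta> \<in> lists A. higman_le x \<beta>}"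

definition down_set :: "'a::order set \<Rightarrow> 'a list \<Rightarrow> 'a list set"
  where "down_set A x = {\<alpha> \<in> lists A. higman_le \<alpha> x}"

text \<open>Intersecting with \<open>lists A\<close> makes the polars of the empty set equal to \<open>lists A\<close>.\<close>

definition upper_polar :: "'a::order set \<Rightarrow> 'a list set \<Rightarrow> 'a list set"
  where "upper_polar A X = lists A \<inter> (\<Inter>x\<in>X. up_set A x)"

definition lower_polar :: "'a::order set \<Rightarrow> 'a list set \<Rightarrow> 'a list set"
  where "lower_polar A X = lists A \<inter> (\<Inter>x\<in>X. down_set A x)"

definition macneille :: "'a::order set \<Rightarrow> 'a list set set"
  where "macneille A = {Y. Y \<subseteq> lists A \<and> Y = upper_polar A (lower_polar A Y)}"

definition lang_concat :: "'a list set \<Rightarrow> 'a list set \<Rightarrow> 'a list set"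
  where "lang_concat X Y = {\<alpha> @ \<beta> | \<alpha> \<beta>. \<alpha> \<in> X \<and> \<beta> \<in> Y}"

definition macneille_monoid :: "'a::order set \<Rightarrow> 'a list set monoid"
  where "macneille_monoid A =
    \<lparr>carrier = macneille A - {{}}, mult = lang_concat, one = lists A\<rparr>"

definition word_monoid :: "'b set \<Rightarrow> 'b list monoid"
  where "word_monoid B = \<lparr>carrier = lists B, mult = (@), one = []\<rparr>"

text \<open>
  A monoid is free if it is isomorphic to the monoid of words over some set. Choosing that set in
  the element type of the monoid is no restriction, see \<open>free_monoidI\<close> below. A bijective
  multiplicative map between monoids preserves the neutral element, so \<open>\<cong>\<close> is isomorphism of
  monoids.
\<close>

definition free_monoid :: "'b monoid \<Rightarrow> bool"
  where "free_monoid M \<longleftrightarrow> monoid M \<and> (\<exists>B :: 'b set. word_monoid B \<cong> M)"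

lemma free_monoidI:
  fixes M :: "'b monoid" and C :: "'c set"
  assumes M: "monoid M" and iso: "word_monoid C \<cong> M"
  shows "free_monoid M"
proof -
  obtain h where h: "h \<in> hom (word_monoid C) M" "bij_betw h (lists C) (carrier M)"
    using iso by (auto simp: is_iso_def iso_def word_monoid_def)
  define b where "b c = h [c]" for c
  have inj: "inj_on b C"
  proof (rule inj_onI)
    fix x y assume "x \<in> C" "y \<in> C" "b x = b y"
    then show "x = y"
      using inj_onD[OF bij_betw_imp_inj_on[OF h(2)], of "[x]" "[y]"] by (simp add: b_def)
  qed
  define k where "k = inv_into C b"
  have k: "bij_betw k (b ` C) C"
    unfolding k_def by (rule bij_betw_inv_into) (use inj in \<open>simp add: bij_betw_def\<close>)
  have mapk: "bij_betw (map k) (lists (b ` C)) (lists C)"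
    using bij_lists[OF k] .
  have "h \<circ> map k \<in> hom (word_monoid (b ` C)) M"
  proof (rule homI)
    fix x assume "x \<in> carrier (word_monoid (b ` C))"
    then show "(h \<circ> map k) x \<in> carrier M"
      using bij_betw_apply[OF bij_betw_trans[OF mapk h(2)]] by (simp add: word_monoid_def)
  next
    fix x y
    assume "x \<in> carrier (word_monoid (b ` C))" "y \<in> carrier (word_monoid (b ` C))"
    then have "map k x \<in> lists C" "map k y \<in> lists C"
      using bij_betw_apply[OF mapk] by (auto simp only: word_monoid_def partial_object.simps)
    then show "(h \<circ> map k) (x \<otimes>\<^bsub>word_monoid (b ` C)\<^esub> y) = (h \<circ> map k) x \<otimes>\<^bsub>M\<^esub> (h \<circ> map k) y"
      using hom_mult[OF h(1), of "map k x" "map k y"] by (simp add: word_monoid_def)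
  qed
  then have "h \<circ> map k \<in> Group.iso (word_monoid (b ` C)) M"
    using bij_betw_trans[OF mapk h(2)] by (simp add: iso_def word_monoid_def)
  then show ?thesis
    using M is_isoI unfolding free_monoid_def by blast
qed

lemma higman_le_iff_list_emb: "higman_le \<alpha> \<beta> \<longleftrightarrow> list_emb (\<le>) \<alpha> \<beta>"
proof
  assume "higman_le \<alpha> \<beta>"
  then show "list_emb (\<le>) \<alpha> \<beta>"
  proof (induction \<beta> arbitrary: \<alpha>)
    case Nil
    then show ?case by (auto simp: higman_le_def)
  next
    case (Cons b \<beta>)
    show ?case
    proof (cases \<alpha>)
      case Nil
      then show ?thesis by simp
    next
      case a: (Cons a \<alpha>')
      obtain h where h: "strict_mono_on {..<length \<alpha>} h" "h ` {..<length \<alpha>} \<subseteq> {..<length (b # \<beta>)}"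
        "\<And>i. i < length \<alpha> \<Longrightarrow> \<alpha> ! i \<le> (b # \<beta>) ! h i"
        using Cons.prems by (auto simp: higman_le_def)
      have lt: "h i < h j" if "i < j" "j < length \<alpha>" for i j
        using h(1) that by (auto simp: strict_mono_on_def)
      have bd: "h i \<le> length \<beta>" if "i < length \<alpha>" for i
        using h(2) that by fastforce
      show ?thesis
      proof (cases "h 0 = 0")
        case True
        have pos: "0 < h (Suc i)" if "i < length \<alpha>'" for i
          using lt[of 0 "Suc i"] that a by simp
        have "higman_le \<alpha>' \<beta>"
          unfolding higman_le_def
        proof (intro exI conjI)
          show "strict_mono_on {..<length \<alpha>'} (\<lambda>i. h (Suc i) - 1)"
            using lt a pos by (auto simp: strict_mono_on_def intro!: diff_less_mono Suc_leI)
          show "(\<lambda>i. h (Suc i) - 1) ` {..<length \<alpha>'} \<subseteq> {..<length \<beta>}"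
            using bd pos a by (fastforce simp: less_eq_Suc_le)
          show "\<forall>i<length \<alpha>'. \<alpha>' ! i \<le> \<beta> ! (h (Suc i) - 1)"
            using h(3)[of "Suc _"] pos a by (fastforce simp: nth_Cons')
        qed
        moreover have "a \<le> b"
          using h(3)[of 0] True a by simp
        ultimately show ?thesis
          using Cons.IH a by auto
      next
        case False
        have pos: "0 < h i" if "i < length \<alpha>" for i
          using lt[of 0 i] that False by (cases i) auto
        have "higman_le \<alpha> \<beta>"
          unfolding higman_le_def
        proof (intro exI conjI)
          show "strict_mono_on {..<length \<alpha>} (\<lambda>i. h i - 1)"
            using lt pos by (auto simp: strict_mono_on_def intro!: diff_less_mono Suc_leI)
          show "(\<lambda>i. h i - 1) ` {..<length \<alpha>} \<subseteq> {..<length \<beta>}"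
            using bd pos by (fastforce simp: less_eq_Suc_le)
          show "\<forall>i<length \<alpha>. \<alpha> ! i \<le> \<beta> ! (h i - 1)"
            using h(3) pos by (fastforce simp: nth_Cons')
        qed
        then show ?thesis
          using Cons.IH by auto
      qed
    qed
  qed
next
  assume "list_emb (\<le>) \<alpha> \<beta>"
  then show "higman_le \<alpha> \<beta>"
  proof induction
    case (list_emb_Nil ys)
    then show ?case by (auto simp: higman_le_def)
  next
    case (list_emb_Cons xs ys y)
    then obtain h where "strict_mono_on {..<length xs} h" "h ` {..<length xs} \<subseteq> {..<length ys}"
      "\<forall>i<length xs. xs ! i \<le> ys ! h i"
      by (auto simp: higman_le_def)
    then show ?case
      unfolding higman_le_def
      by (intro exI[of _ "\<lambda>i. Suc (h i)"]) (auto simp: strict_mono_on_def)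
  next
    case (list_emb_Cons2 x y xs ys)
    then obtain h where h: "strict_mono_on {..<length xs} h" "h ` {..<length xs} \<subseteq> {..<length ys}"
      "\<forall>i<length xs. xs ! i \<le> ys ! h i"
      by (auto simp: higman_le_def)
    show ?case
      unfolding higman_le_def
    proof (intro exI conjI)
      show "strict_mono_on {..<length (x # xs)} (case_nat 0 (\<lambda>i. Suc (h i)))"
        using h(1) by (auto simp: strict_mono_on_def split: nat.splits)
      show "case_nat 0 (\<lambda>i. Suc (h i)) ` {..<length (x # xs)} \<subseteq> {..<length (y # ys)}"
        using h(2) by (fastforce split: nat.splits)
      show "\<forall>i<length (x # xs). (x # xs) ! i \<le> (y # ys) ! case_nat 0 (\<lambda>i. Suc (h i)) i"
        using h(3) list_emb_Cons2.hyps by (auto split: nat.splits)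
    qed
  qed
qed

end

theory Submission
  imports Defs
begin

text \<open>
  A monoid is free as soon as it carries an additive natural-valued length vanishing only at the
  unit and satisfies Levi's lemma: \<open>a b = c d\<close> implies that one of \<open>a\<close>, \<open>c\<close> is a right multiple of
  the other, compatibly with \<open>b\<close> and \<open>d\<close>. On nonempty closed sets the length of \<open>Y\<close> is the length of
  a shortest word of \<open>Y\<close>. For Levi's lemma, let \<open>X Y = Z W\<close>. If \<open>X\<close> and \<open>Z\<close> were incomparable, every
  word of \<open>Y\<close> would have a proper suffix in \<open>W\<close> and conversely, an infinite descent. If
  \<open>X \<subseteq> Z\<close>, the common factor is the residual \<open>{u. u Y \<subseteq> W}\<close>, which is closed.
\<close>

section \<open>Freeness from a length function and Levi's lemma\<close>

locale levi_monoid = monoid M for M :: "'b monoid" (structure) +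
  fixes len :: "'b \<Rightarrow> nat"
  assumes len_mult: "\<lbrakk>x \<in> carrier M; y \<in> carrier M\<rbrakk> \<Longrightarrow> len (x \<otimes> y) = len x + len y"
    and len_eq_0: "x \<in> carrier M \<Longrightarrow> len x = 0 \<longleftrightarrow> x = \<one>"
    and levi: "\<lbrakk>a \<in> carrier M; b \<in> carrier M; c \<in> carrier M; d \<in> carrier M; a \<otimes> b = c \<otimes> d\<rbrakk> \<Longrightarrow>
      \<exists>u\<in>carrier M. (a = c \<otimes> u \<and> d = u \<otimes> b) \<or> (c = a \<otimes> u \<and> b = u \<otimes> d)"
begin

lemma len_pos: "x \<in> carrier M \<Longrightarrow> x \<noteq> \<one> \<Longrightarrow> 0 < len x"
  using len_eq_0 by blast

definition irreducibles :: "'b set"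
  where "irreducibles = {b \<in> carrier M. b \<noteq> \<one> \<and>
    (\<forall>x\<in>carrier M. \<forall>y\<in>carrier M. b = x \<otimes> y \<longrightarrow> x = \<one> \<or> y = \<one>)}"

definition product :: "'b list \<Rightarrow> 'b"
  where "product bs = foldr (\<otimes>) bs \<one>"

lemma product_simps [simp]: "product [] = \<one>" "product (b # bs) = b \<otimes> product bs"
  by (simp_all add: product_def)

lemma irreducibles_carrier: "b \<in> irreducibles \<Longrightarrow> b \<in> carrier M"
  by (simp add: irreducibles_def)

lemma product_closed: "bs \<in> lists irreducibles \<Longrightarrow> product bs \<in> carrier M"
  by (induction bs) (auto simp: irreducibles_carrier)

lemma product_append:
  "\<lbrakk>bs \<in> lists irreducibles; cs \<in> lists irreducibles\<rbrakk> \<Longrightarrow> product (bs @ cs) = product bs \<otimes> product cs"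
  by (induction bs) (auto simp: irreducibles_carrier product_closed m_assoc)

text \<open>An irreducible first factor already makes the additive length positive. This separates
  the empty word from all others in the injectivity proof.\<close>

lemma product_Cons_neq_one:
  assumes "b # bs \<in> lists irreducibles"
  shows "product (b # bs) \<noteq> \<one>"
proof -
  have b: "b \<in> carrier M" "b \<noteq> \<one>" "product bs \<in> carrier M"
    using assms product_closed by (auto simp: irreducibles_def)
  then have "0 < len (product (b # bs))"
    by (simp add: len_mult len_pos)
  then show ?thesis
    using len_eq_0[OF one_closed] by auto
qed

lemma irreducible_mult_cancel:
  assumes "b \<in> irreducibles" "c \<in> irreducibles" "x \<in> carrier M" "y \<in> carrier M"
    and "b \<otimes> x = c \<otimes> y"
  shows "b = c \<and> x = y"
proof -
  have b: "b \<in> carrier M" "c \<in> carrier M" "b \<noteq> \<one>" "c \<noteq> \<one>"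
    using assms by (auto simp: irreducibles_def)
  obtain u where "u \<in> carrier M" "b = c \<otimes> u \<and> y = u \<otimes> x \<or> c = b \<otimes> u \<and> x = u \<otimes> y"
    using levi[of b x c y] b assms by auto
  \<comment> \<open>In \<open>b = c \<otimes> u\<close> the factor \<open>c\<close> is not the unit,
    so irreducibility of \<open>b\<close> makes \<open>u\<close> the unit; the other case is
    symmetric.\<close>
  moreover from this have "u = \<one>"
    using assms(1,2) b unfolding irreducibles_def by blast
  ultimately show ?thesis
    using b assms(3,4) by auto
qed

lemma product_inj:
  "\<lbrakk>bs \<in> lists irreducibles; cs \<in> lists irreducibles; product bs = product cs\<rbrakk> \<Longrightarrow> bs = cs"
proof (induction bs arbitrary: cs)
  case Nil
  then show ?case
    using product_Cons_neq_one by (cases cs) (auto simp del: product_simps(2))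
next
  case (Cons b bs)
  show ?case
  proof (cases cs)
    case Nil
    then show ?thesis
      using Cons.prems product_Cons_neq_one by auto
  next
    case (Cons c cs')
    then have "b = c \<and> product bs = product cs'"
      using Cons.prems by (intro irreducible_mult_cancel) (auto intro: product_closed)
    then show ?thesis
      using Cons Cons.IH Cons.prems by auto
  qed
qed

text \<open>Both factors of a nontrivial factorization have positive length, hence are strictly
  shorter than the product, so strong induction on the length applies.\<close>

lemma product_surj: "x \<in> carrier M \<Longrightarrow> x \<in> product ` lists irreducibles"
proof (induction "len x" arbitrary: x rule: less_induct)
  case less
  consider "x = \<one>" | "x \<in> irreducibles"
    | y z where "y \<in> carrier M" "z \<in> carrier M" "x = y \<otimes> z" "y \<noteq> \<one>" "z \<noteq> \<one>"
    using less.prems unfolding irreducibles_def by blast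
  then show ?case
  proof cases
    case 1
    then show ?thesis by (auto intro!: image_eqI[of _ _ "[]"])
  next
    case 2
    then show ?thesis by (auto intro!: image_eqI[of _ _ "[x]"] simp: irreducibles_carrier)
  next
    case 3
    then have "len y < len x" "len z < len x"
      by (simp_all add: len_mult len_pos)
    then obtain bs cs where "bs \<in> lists irreducibles" "y = product bs"
        "cs \<in> lists irreducibles" "z = product cs"
      using less.hyps 3 by blast
    then show ?thesis
      using 3 product_append by (intro image_eqI[of _ _ "bs @ cs"]) auto
  qed
qed

lemma free: "free_monoid M"
proof -
  have "product \<in> hom (word_monoid irreducibles) M"
    by (rule homI) (auto simp: word_monoid_def product_closed product_append)
  moreover have "bij_betw product (lists irreducibles) (carrier M)"
  proof (rule bij_betw_imageI)
    show "inj_on product (lists irreducibles)"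
      by (rule inj_onI) (rule product_inj)
    show "product ` lists irreducibles = carrier M"
      by (intro equalityI subsetI product_surj) (metis imageE product_closed)
  qed
  ultimately have "product \<in> iso (word_monoid irreducibles) M"
    by (simp add: iso_def word_monoid_def)
  then show ?thesis
    unfolding free_monoid_def using monoid_axioms is_isoI by blast
qed

end

section \<open>Closed languages and separating lower bounds\<close>

text \<open>These classical rules make \<open>blast\<close> diverge on sets of words.\<close>
declare in_listsD [rule del] in_listsI [rule del]

text \<open>The inclusion of \<open>Y\<close> in its double polar is automatic, so closedness only
  demands that each word outside \<open>Y\<close> fail to lie above some lower bound of
  \<open>Y\<close>.\<close>

lemma macneille_iff:
  "Y \<in> macneille A \<longleftrightarrow> Y \<subseteq> lists A \<and>
    (\<forall>w\<in>lists A - Y. \<exists>l\<in>lists A. (\<forall>y\<in>Y. list_emb (\<le>) l y) \<and> \<not> list_emb (\<le>) l w)"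
proof -
  \<comment> \<open>No property of the order matters here: for an arbitrary relation
    \<open>R\<close> the equivalence is pure set algebra.\<close>
  have "Y \<subseteq> L \<and> Y = L \<inter> (\<Inter>x\<in>L \<inter> (\<Inter>y\<in>Y. {l \<in> L. R l y}). {w \<in> L. R x w}) \<longleftrightarrow>
      Y \<subseteq> L \<and> (\<forall>w\<in>L - Y. \<exists>l\<in>L. (\<forall>y\<in>Y. R l y) \<and> \<not> R l w)"
    for L and R :: "'a list \<Rightarrow> 'a list \<Rightarrow> bool"
    by blast
  then show ?thesis
    unfolding macneille_def upper_polar_def lower_polar_def up_set_def down_set_def
      higman_le_iff_list_emb mem_Collect_eq .
qed

lemma macneille_separation:
  assumes "Y \<in> macneille A" "w \<in> lists A" "w \<notin> Y"
  obtains l where "l \<in> lists A" "\<And>y. y \<in> Y \<Longrightarrow> list_emb (\<le>) l y" "\<not> list_emb (\<le>) l w"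
  using assms unfolding macneille_iff by blast

lemma macneille_lists: "Y \<in> macneille A \<Longrightarrow> y \<in> Y \<Longrightarrow> y \<in> lists A"
  unfolding macneille_iff by blast

lemma macneille_up_closed:
  assumes "Y \<in> macneille A" "y \<in> Y" "w \<in> lists A" "list_emb (\<le>) y w"
  shows "w \<in> Y"
proof (rule ccontr)
  assume "w \<notin> Y"
  then obtain l where "list_emb (\<le>) l y" "\<not> list_emb (\<le>) l w"
    using macneille_separation assms by metis
  then show False
    using list_emb_trans[of l y w "(\<le>)"] assms(4) by auto
qed

lemma list_emb_refl_le: "list_emb (\<le>) x (x :: 'a::order list)"
  by (rule list_emb_refl) simp

lemma macneille_append_left:
  "\<lbrakk>Y \<in> macneille A; y \<in> Y; v \<in> lists A\<rbrakk> \<Longrightarrow> v @ y \<in> Y"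
  using macneille_up_closed[of Y A y "v @ y"] macneille_lists[of Y A y]
    list_emb_append2[OF list_emb_refl_le, of y v]
  by simp

lemma macneille_append_right:
  "\<lbrakk>Y \<in> macneille A; y \<in> Y; v \<in> lists A\<rbrakk> \<Longrightarrow> y @ v \<in> Y"
  using macneille_up_closed[of Y A y "y @ v"] macneille_lists[of Y A y]
    list_emb_prefix[OF list_emb_refl_le, of y v]
  by simp

lemma lists_in_macneille: "lists A \<in> macneille A"
  unfolding macneille_iff by auto

lemma macneille_Nil: "Y \<in> macneille A \<Longrightarrow> [] \<in> Y \<Longrightarrow> Y = lists A"
  using macneille_up_closed[of Y A "[]"] macneille_lists by blast

section \<open>Concatenation of languages and its neutral element\<close>

lemma lang_concatI: "\<lbrakk>x \<in> X; y \<in> Y\<rbrakk> \<Longrightarrow> x @ y \<in> lang_concat X Y"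
  unfolding lang_concat_def by blast

lemma lang_concatE:
  assumes "w \<in> lang_concat X Y"
  obtains x y where "x \<in> X" "y \<in> Y" "w = x @ y"
  using assms unfolding lang_concat_def by blast

lemma lang_concat_mono: "X \<subseteq> X' \<Longrightarrow> Y \<subseteq> Y' \<Longrightarrow> lang_concat X Y \<subseteq> lang_concat X' Y'"
  unfolding lang_concat_def by blast

lemma lang_concat_assoc: "lang_concat (lang_concat X Y) Z = lang_concat X (lang_concat Y Z)"
proof (intro equalityI subsetI)
  fix w assume "w \<in> lang_concat (lang_concat X Y) Z"
  then show "w \<in> lang_concat X (lang_concat Y Z)"
    by (elim lang_concatE) (simp add: lang_concatI)
next
  fix w assume "w \<in> lang_concat X (lang_concat Y Z)"
  then show "w \<in> lang_concat (lang_concat X Y) Z"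
    by (elim lang_concatE) (simp add: lang_concatI flip: append_assoc)
qed

lemma lang_concat_lists_left:
  assumes "Y \<in> macneille A"
  shows "lang_concat (lists A) Y = Y"
proof
  show "lang_concat (lists A) Y \<subseteq> Y"
    using macneille_append_left[OF assms] by (blast elim: lang_concatE)
  show "Y \<subseteq> lang_concat (lists A) Y"
    using lang_concatI[of "[]" "lists A" _ Y] by auto
qed

lemma lang_concat_lists_right:
  assumes "Y \<in> macneille A"
  shows "lang_concat Y (lists A) = Y"
proof
  show "lang_concat Y (lists A) \<subseteq> Y"
    using macneille_append_right[OF assms] by (blast elim: lang_concatE)
  show "Y \<subseteq> lang_concat Y (lists A)"
    using lang_concatI[of _ Y "[]" "lists A"] by auto
qed

lemma lang_concat_neq_empty: "X \<noteq> {} \<Longrightarrow> Y \<noteq> {} \<Longrightarrow> lang_concat X Y \<noteq> {}"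
  unfolding lang_concat_def by blast

section \<open>Closure of the completion under concatenation\<close>

text \<open>Levi's lemma for words, with the lengths deciding which alternative occurs.\<close>

lemma append_eq_append_le:
  assumes "p @ q = x @ v" "length x \<le> length p"
  obtains r where "p = x @ r" "v = r @ q"
proof -
  have "x = take (length x) p"
    using arg_cong[OF assms(1), of "take (length x)"] assms(2) by simp
  then have "p = x @ drop (length x) p"
    by (metis append_take_drop_id)
  moreover from this have "v = drop (length x) p @ q"
    using assms(1) by (metis append.assoc same_append_eq)
  ultimately show ?thesis
    by (rule that)
qed

lemma shortest_word:
  fixes Y :: "'a list set"
  assumes "Y \<noteq> {}"
  obtains y where "y \<in> Y" "\<And>z. z \<in> Y \<Longrightarrow> length y \<le> length z"
  using ex_has_least_nat[of "\<lambda>y. y \<in> Y" _ length] assms by blast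

lemma shortest_prefix:
  assumes "w \<in> Y"
  obtains x v where "w = x @ v" "x \<in> Y" "\<And>p q. p @ q = w \<Longrightarrow> p \<in> Y \<Longrightarrow> length x \<le> length p"
proof -
  have "{p \<in> Y. prefix p w} \<noteq> {}"
    using assms by auto
  then obtain x where "x \<in> {p \<in> Y. prefix p w}"
    "\<And>p. p \<in> {p \<in> Y. prefix p w} \<Longrightarrow> length x \<le> length p"
    using shortest_word[of "{p \<in> Y. prefix p w}"] by metis
  then have x: "x \<in> Y" "prefix x w" "\<And>p. p \<in> Y \<Longrightarrow> prefix p w \<Longrightarrow> length x \<le> length p"
    by simp_all
  then obtain v where "w = x @ v"
    by (auto simp: prefix_def)
  with x show ?thesis
    by (metis that prefixI)
qed

text \<open>For \<open>w\<close> outside the product, a separator of \<open>w\<close> from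
  \<open>Y\<close> suffices if \<open>w \<notin> Y\<close>. Otherwise \<open>w\<close> is cut after
  its shortest prefix \<open>x\<close> in \<open>Y\<close>; the rest \<open>v\<close> is not in
  \<open>Z\<close>, and a separator for \<open>w\<close> is composed of a lower bound of
  \<open>Y\<close> and one of \<open>Z\<close>.\<close>

lemma macneille_lang_concat:
  assumes Y: "Y \<in> macneille A" and Z: "Z \<in> macneille A"
  shows "lang_concat Y Z \<in> macneille A"
  unfolding macneille_iff
proof (intro conjI ballI)
  show "lang_concat Y Z \<subseteq> lists A"
    using macneille_lists[OF Y] macneille_lists[OF Z] by (auto elim!: lang_concatE)
next
  fix w assume w: "w \<in> lists A - lang_concat Y Z"
  show "\<exists>l\<in>lists A. (\<forall>y\<in>lang_concat Y Z. list_emb (\<le>) l y) \<and> \<not> list_emb (\<le>) l w"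
  proof (cases "w \<in> Y")
    case False
    then obtain l where "l \<in> lists A" "\<And>y. y \<in> Y \<Longrightarrow> list_emb (\<le>) l y" "\<not> list_emb (\<le>) l w"
      using macneille_separation[OF Y] w by blast
    then show ?thesis
      by (intro bexI[of _ l]) (auto elim!: lang_concatE intro: list_emb_prefix)
  next
    case True
    then obtain x v where x: "w = x @ v" "x \<in> Y"
      "\<And>p q. p @ q = w \<Longrightarrow> p \<in> Y \<Longrightarrow> length x \<le> length p"
      using shortest_prefix[of w Y] by metis
    then have "v \<notin> Z" "v \<in> lists A"
      using w lang_concatI by fastforce+
    then obtain m where m: "m \<in> lists A" "\<And>z. z \<in> Z \<Longrightarrow> list_emb (\<le>) m z" "\<not> list_emb (\<le>) m v"
      using macneille_separation[OF Z] by blast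
    have "\<exists>l\<in>lists A. (\<forall>y\<in>Y. list_emb (\<le>) l y) \<and>
        (\<forall>p q. p @ q = w \<longrightarrow> list_emb (\<le>) l p \<longrightarrow> length x \<le> length p)"
    proof (cases x rule: rev_cases)
      case Nil
      then show ?thesis by (intro bexI[of _ "[]"]) auto
    next
      \<comment> \<open>By minimality of \<open>x\<close>, the word \<open>x'\<close> is outside
        \<open>Y\<close> and is separated by some \<open>l\<close>. A prefix of \<open>w\<close>
        shorter than \<open>x\<close> is a prefix of \<open>x'\<close>, so \<open>l\<close> cannot
        embed into it.\<close>
      case (snoc x' a)
      have "x' \<notin> Y" "x' \<in> lists A"
        using x(3)[of x' "a # v"] x(1) snoc w by auto
      then obtain l where l: "l \<in> lists A" "\<And>y. y \<in> Y \<Longrightarrow> list_emb (\<le>) l y" "\<not> list_emb (\<le>) l x'"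
        using macneille_separation[OF Y] by blast
      have "length x \<le> length p" if "p @ q = w" "list_emb (\<le>) l p" for p q
      proof (rule ccontr)
        assume "\<not> length x \<le> length p"
        then have "length p \<le> length x'"
          using snoc by simp
        moreover have "x' @ (a # v) = p @ q"
          using that(1) x(1) snoc by simp
        ultimately obtain r where "x' = p @ r"
          using append_eq_append_le by blast
        then show False
          using l(3) list_emb_prefix[OF that(2)] by simp
      qed
      then show ?thesis
        using l by blast
    qed
    then obtain l where l: "l \<in> lists A" "\<And>y. y \<in> Y \<Longrightarrow> list_emb (\<le>) l y"
      "\<And>p q. p @ q = w \<Longrightarrow> list_emb (\<le>) l p \<Longrightarrow> length x \<le> length p"
      by blast
    \<comment> \<open>In an embedding of \<open>l @ m\<close>, the part \<open>l\<close> would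
      consume a prefix at least as long as \<open>x\<close>, leaving \<open>m\<close> to embed into
      a suffix of \<open>v\<close>.\<close>
    have "\<not> list_emb (\<le>) (l @ m) w"
    proof
      assume "list_emb (\<le>) (l @ m) w"
      then obtain p q where pq: "w = p @ q" "list_emb (\<le>) l p" "list_emb (\<le>) m q"
        by (auto dest: list_emb_appendD)
      then have "length x \<le> length p"
        using l(3) by blast
      then obtain r where "v = r @ q"
        using append_eq_append_le[of p q x v] pq(1) x(1) by auto
      then show False
        using m(3) list_emb_append2[OF pq(3)] by simp
    qed
    then show ?thesis
      using l m by (intro bexI[of _ "l @ m"]) (auto elim!: lang_concatE intro: list_emb_append_mono)
  qed
qed

section \<open>Residuals of closed languages\<close>

text \<open>Counterpart of \<open>list_emb_appendD\<close>: the larger word is cut instead of the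
  smaller one.\<close>

lemma list_emb_append_rightD:
  assumes "list_emb P xs (us @ vs)"
  obtains ys zs where "xs = ys @ zs" "list_emb P ys us" "list_emb P zs vs"
proof -
  have "\<exists>ys zs. xs = ys @ zs \<and> list_emb P ys us \<and> list_emb P zs vs"
    using assms
  proof (induction us arbitrary: xs)
    case (Cons u us)
    from Cons.prems have "list_emb P xs (u # (us @ vs))"
      by simp
    then show ?case
    proof cases
      case list_emb_Cons
      then show ?thesis
        using Cons.IH by (metis list_emb.list_emb_Cons)
    next
      case (list_emb_Cons2 x xs')
      then obtain ys zs where "xs' = ys @ zs" "list_emb P ys us" "list_emb P zs vs"
        using Cons.IH by metis
      then show ?thesis
        using list_emb_Cons2 by (intro exI[of _ "x # ys"] exI[of _ zs]) simp
    qed auto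
  qed auto
  then show ?thesis
    using that by blast
qed

text \<open>The largest language over \<open>A\<close> whose product with \<open>B\<close> is
  contained in \<open>D\<close>.\<close>

definition residual :: "'a set \<Rightarrow> 'a list set \<Rightarrow> 'a list set \<Rightarrow> 'a list set"
  where "residual A D B = {u \<in> lists A. \<forall>b\<in>B. u @ b \<in> D}"

lemma macneille_residual:
  assumes D: "D \<in> macneille A" and B: "B \<subseteq> lists A"
  shows "residual A D B \<in> macneille A"
  unfolding macneille_iff
proof (intro conjI ballI)
  show "residual A D B \<subseteq> lists A"
    by (auto simp: residual_def)
next
  fix w assume "w \<in> lists A - residual A D B"
  then obtain b where b: "b \<in> B" "w @ b \<notin> D" "w \<in> lists A"
    by (auto simp: residual_def)
  then have "w @ b \<in> lists A"
    using B subsetD by simp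
  then obtain x where x: "x \<in> lists A" "\<And>d. d \<in> D \<Longrightarrow> list_emb (\<le>) x d" "\<not> list_emb (\<le>) x (w @ b)"
    using macneille_separation[OF D _ b(2)] by metis
  \<comment> \<open>The part of \<open>x\<close> left over by its longest suffix embedding into \<open>b\<close> separates \<open>w\<close>.\<close>
  define P where "P = {p. \<exists>s. x = p @ s \<and> list_emb (\<le>) s b}"
  have "x \<in> P"
    by (auto simp: P_def)
  then obtain p where p: "p \<in> P" "\<And>p'. p' \<in> P \<Longrightarrow> length p \<le> length p'"
    using shortest_word[of P] by blast
  then obtain s where s: "x = p @ s" "list_emb (\<le>) s b"
    by (auto simp: P_def)
  have "list_emb (\<le>) p u" if "u \<in> residual A D B" for u
  proof -
    have "list_emb (\<le>) x (u @ b)"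
      using that b x(2) by (simp add: residual_def)
    then obtain p' s' where p': "x = p' @ s'" "list_emb (\<le>) p' u" "list_emb (\<le>) s' b"
      using list_emb_append_rightD by blast
    \<comment> \<open>The remainder \<open>p'\<close> belongs to \<open>P\<close>, so minimality
      makes \<open>p\<close> a prefix of it.\<close>
    then have "length p \<le> length p'"
      using p by (auto simp: P_def)
    then obtain r where "p' = p @ r"
      using append_eq_append_le[of p' s' p s] p'(1) s(1) by auto
    then show ?thesis
      using p'(2) by (metis list_emb_appendD list_emb_prefix)
  qed
  moreover have "\<not> list_emb (\<le>) p w"
    using x(3) s list_emb_append_mono by blast
  ultimately show "\<exists>l\<in>lists A. (\<forall>y\<in>residual A D B. list_emb (\<le>) l y) \<and> \<not> list_emb (\<le>) l w"
    using x(1) s(1) by (intro bexI[of _ p]) auto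
qed

section \<open>Cancellation of nonempty factors\<close>

text \<open>With \<open>x\<close> a shortest word of \<open>X\<close>, an equation
  \<open>x @ y = x' @ z\<close> makes \<open>z\<close> a suffix of \<open>y\<close>, and
  \<open>Z\<close> is closed under prepending words. The right-hand version is the mirror image,
  with \<open>z\<close> a prefix of \<open>y\<close>.\<close>

lemma lang_concat_cancel_left:
  assumes X: "X \<subseteq> lists A" "X \<noteq> {}" and Y: "Y \<subseteq> lists A" and Z: "Z \<in> macneille A"
    and "lang_concat X Y \<subseteq> lang_concat X Z"
  shows "Y \<subseteq> Z"
proof
  fix y assume y: "y \<in> Y"
  obtain x where x: "x \<in> X" "\<And>x'. x' \<in> X \<Longrightarrow> length x \<le> length x'"
    using shortest_word X(2) by blast
  then have "x @ y \<in> lang_concat X Z"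
    using assms(5) y lang_concatI by blast
  then obtain x' z where z: "x' \<in> X" "z \<in> Z" "x @ y = x' @ z"
    by (blast elim: lang_concatE)
  then obtain v where "y = v @ z"
    using append_eq_append_le[of x' z x y] x(2)[of x'] by auto
  then show "y \<in> Z"
    using macneille_append_left[OF Z z(2)] Y y by auto
qed

lemma lang_concat_cancel_right:
  assumes X: "X \<subseteq> lists A" "X \<noteq> {}" and Y: "Y \<subseteq> lists A" and Z: "Z \<in> macneille A"
    and "lang_concat Y X \<subseteq> lang_concat Z X"
  shows "Y \<subseteq> Z"
proof
  fix y assume y: "y \<in> Y"
  obtain x where x: "x \<in> X" "\<And>x'. x' \<in> X \<Longrightarrow> length x \<le> length x'"
    using shortest_word X(2) by blast
  then have "y @ x \<in> lang_concat Z X"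
    using assms(5) y lang_concatI by blast
  then obtain x' z where z: "x' \<in> X" "z \<in> Z" "y @ x = z @ x'"
    by (blast elim: lang_concatE)
  moreover have "length z \<le> length y"
    using x(2)[OF z(1)] arg_cong[OF z(3), of length] by simp
  ultimately obtain v where "y = z @ v"
    using append_eq_append_le by blast
  then show "y \<in> Z"
    using macneille_append_right[OF Z z(2)] Y y by auto
qed

section \<open>Levi's lemma for closed languages\<close>

text \<open>In \<open>a @ b = c @ d\<close> the word \<open>c\<close> cannot be a prefix of
  \<open>a\<close>, since \<open>C\<close> is closed under appending words and misses
  \<open>a\<close>. So \<open>c\<close> is longer than \<open>a\<close>, and \<open>d\<close> is
  shorter than \<open>b\<close>.\<close>

lemma shorter_suffix:
  assumes A': "A' \<in> macneille A" and C: "C \<in> macneille A"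
    and eq: "lang_concat A' B = lang_concat C D"
    and a: "a \<in> A'" "a \<notin> C" and b: "b \<in> B"
  shows "\<exists>d\<in>D. length d < length b"
proof -
  have "a @ b \<in> lang_concat C D"
    using eq a b lang_concatI by blast
  then obtain c d where cd: "c \<in> C" "d \<in> D" "a @ b = c @ d"
    by (blast elim: lang_concatE)
  have "\<not> length c \<le> length a"
  proof
    assume "length c \<le> length a"
    then obtain v where "a = c @ v"
      using append_eq_append_le[OF cd(3)] by blast
    then show False
      using macneille_append_right[OF C cd(1)] macneille_lists[OF A' a(1)] a(2) by auto
  qed
  then show ?thesis
    using cd(2) arg_cong[OF cd(3), of length] by (intro bexI[of _ d]) auto
qed

lemma prefix_comparable:
  assumes A': "A' \<in> macneille A" and C: "C \<in> macneille A" and B: "B \<noteq> {}"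
    and eq: "lang_concat A' B = lang_concat C D"
  shows "A' \<subseteq> C \<or> C \<subseteq> A'"
proof (rule ccontr)
  assume "\<not> ?thesis"
  then obtain a c where a: "a \<in> A'" "a \<notin> C" and c: "c \<in> C" "c \<notin> A'"
    by blast
  \<comment> \<open>Starting from a shortest \<open>b\<close>, two descent steps, to
    \<open>D\<close> and back to \<open>B\<close>, already give a contradiction.\<close>
  obtain b where b: "b \<in> B" "\<And>b'. b' \<in> B \<Longrightarrow> length b \<le> length b'"
    using shortest_word B by blast
  then show False
    using shorter_suffix[OF A' C eq a] shorter_suffix[OF C A' eq[symmetric] c]
    by (meson less_trans linorder_not_less)
qed

lemma levi_subset:
  assumes A': "A' \<in> macneille A" "A' \<noteq> {}" and B: "B \<in> macneille A" "B \<noteq> {}"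
    and C: "C \<in> macneille A" "C \<noteq> {}" and D: "D \<in> macneille A"
    and eq: "lang_concat A' B = lang_concat C D" and sub: "A' \<subseteq> C"
  shows "\<exists>U\<in>macneille A - {{}}. A' = lang_concat C U \<and> D = lang_concat U B"
proof -
  have sets: "A' \<subseteq> lists A" "B \<subseteq> lists A" "C \<subseteq> lists A" "D \<subseteq> lists A"
    using A' B C D by (auto dest: macneille_lists)
  define U where "U = residual A D B"
  have U: "U \<in> macneille A"
    unfolding U_def using macneille_residual D sets by blast
  have "lang_concat U B \<subseteq> D"
    by (auto simp: U_def residual_def elim!: lang_concatE)
  \<comment> \<open>Cancelling \<open>B\<close> on the right then puts the product of
    \<open>C\<close> and \<open>U\<close> inside \<open>A'\<close>.\<close>
  then have "lang_concat (lang_concat C U) B \<subseteq> lang_concat A' B"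
    unfolding eq lang_concat_assoc by (intro lang_concat_mono) auto
  then have "lang_concat C U \<subseteq> A'"
    using lang_concat_cancel_right[OF sets(2) B(2) _ A'(1)] macneille_lists[OF macneille_lang_concat[OF C(1) U]]
    by blast
  moreover have "A' \<subseteq> lang_concat C U"
  proof
    fix a assume a: "a \<in> A'"
    have aC: "a \<in> C"
      using a sub by blast
    \<comment> \<open>Cutting \<open>a\<close> after its shortest prefix in \<open>C\<close> leaves
      a remainder \<open>u\<close> that is shown to lie in the residual.\<close>
    obtain c u where c: "a = c @ u" "c \<in> C"
      "\<And>p q. p @ q = a \<Longrightarrow> p \<in> C \<Longrightarrow> length c \<le> length p"
      using shortest_prefix[OF aC] by metis
    have "u @ b \<in> D" if b: "b \<in> B" for b
    proof -
      have "a @ b \<in> lang_concat C D"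
        using eq a b lang_concatI by blast
      then obtain c' d where cd: "c' \<in> C" "d \<in> D" "a @ b = c' @ d"
        by (blast elim: lang_concatE)
      \<comment> \<open>Either \<open>c'\<close> is a prefix of \<open>a\<close> in
        \<open>C\<close>, and minimality of \<open>c\<close> applies, or it is longer than
        \<open>a\<close>. Consequently \<open>d\<close> is a suffix of \<open>u @ b\<close>.\<close>
      have "length c \<le> length c'"
      proof (cases "length c' \<le> length a")
        case True
        then obtain q where "c' @ q = a"
          using append_eq_append_le[OF cd(3)] by metis
        then show ?thesis
          using c(3) cd(1) by blast
      qed (use c(1) in simp)
      moreover have "c' @ d = c @ (u @ b)"
        using cd(3) c(1) by simp
      ultimately obtain v where v: "u @ b = v @ d"
        using append_eq_append_le by blast
      moreover have "u @ b \<in> lists A"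
        using sets a b c(1) by auto
      ultimately show ?thesis
        using macneille_append_left[OF D cd(2), of v] by auto
    qed
    then have "u \<in> U"
      using sets(1) a c(1) by (auto simp: U_def residual_def)
    then show "a \<in> lang_concat C U"
      using c lang_concatI by blast
  qed
  ultimately have AU: "A' = lang_concat C U"
    by (rule equalityI[rotated])
  \<comment> \<open>Left cancellation of \<open>C\<close>, used for both inclusions, yields the
    second factorization.\<close>
  then have "lang_concat C D = lang_concat C (lang_concat U B)"
    using eq by (simp add: lang_concat_assoc)
  then have "D = lang_concat U B"
    using macneille_lang_concat[OF U B(1)] D sets C(2) lang_concat_cancel_left[of C A]
    by (metis macneille_lists subset_antisym subset_refl subsetI)
  moreover have "U \<noteq> {}"
    using AU A'(2) by (auto simp: lang_concat_def)
  ultimately show ?thesis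
    using AU U by blast
qed

section \<open>Length of a shortest word as the length function\<close>

definition min_length :: "'a list set \<Rightarrow> nat"
  where "min_length Y = (INF y\<in>Y. length y)"

lemma min_length_le: "y \<in> Y \<Longrightarrow> min_length Y \<le> length y"
  unfolding min_length_def by (rule cINF_lower) auto

lemma min_length_attained:
  assumes "Y \<noteq> {}"
  obtains y where "y \<in> Y" "length y = min_length Y"
  using Inf_nat_def1[of "length ` Y"] assms unfolding min_length_def by (metis imageE image_is_empty)

lemma min_length_lang_concat:
  assumes "X \<noteq> {}" "Y \<noteq> {}"
  shows "min_length (lang_concat X Y) = min_length X + min_length Y"
proof (rule antisym)
  show "min_length (lang_concat X Y) \<le> min_length X + min_length Y"
    using assms by (metis lang_concatI length_append min_length_attained min_length_le)
  obtain w where "w \<in> lang_concat X Y" "length w = min_length (lang_concat X Y)"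
    using min_length_attained lang_concat_neq_empty[OF assms] by blast
  then show "min_length X + min_length Y \<le> min_length (lang_concat X Y)"
    by (metis add_mono lang_concatE length_append min_length_le)
qed

text \<open>Length zero means that the empty word, which lies below every word, belongs to the
  upward closed set \<open>Y\<close>.\<close>

lemma min_length_eq_0:
  assumes "Y \<in> macneille A" "Y \<noteq> {}"
  shows "min_length Y = 0 \<longleftrightarrow> Y = lists A"
proof
  assume "min_length Y = 0"
  then show "Y = lists A"
    using macneille_Nil[OF assms(1)] min_length_attained[OF assms(2)] by (metis length_0_conv)
next
  assume "Y = lists A"
  then show "min_length Y = 0"
    using min_length_le[of "[]" Y] by simp
qed

theorem theorem3:
  fixes A :: "'a::order set"
  shows "free_monoid (macneille_monoid A)"
proof -
  interpret levi_monoid "macneille_monoid A" min_length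
  \<comment> \<open>Goals 1 to 5 are the monoid laws, 6 and 7 the length laws, and 8 is Levi's
    lemma.\<close>
  proof (unfold_locales, unfold macneille_monoid_def, simp_all, goal_cases)
    case (1 x y)
    then show ?case by (simp add: macneille_lang_concat lang_concat_neq_empty)
  next
    case 2
    show ?case by (rule lang_concat_assoc)
  next
    case 3
    then show ?case by (auto simp: lists_in_macneille)
  next
    case 4
    then show ?case by (simp add: lang_concat_lists_left)
  next
    case 5
    then show ?case by (simp add: lang_concat_lists_right)
  next
    case 6
    then show ?case by (simp add: min_length_lang_concat)
  next
    case 7
    then show ?case using min_length_eq_0 by auto
  next
    \<comment> \<open>The factors \<open>a\<close> and \<open>c\<close> are comparable; the two
      instances of \<open>levi_subset\<close> treat the two inclusions and give the two
      alternatives.\<close>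
    case (8 a b c d)
    then show ?case
      using prefix_comparable[of a A c b d] levi_subset[of a A b c d] levi_subset[of c A d a b]
      by auto
  qed
  show ?thesis by (rule free)
qed

end
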